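(* Let $\mathscr{S} \ni s \mapsto T_s \in \mathscr{L}(X)$ be a homomorphism of a weakly right amenable SGT $\mathscr{S}$ into $\mathscr{L}(X)$ (where $(X,\|\cdot\|_X)$ is a Banach space) that is continuous in the strong operator topology of $\mathscr{L}(X)$. Further, let $m$ and $M$ be two positive real constants such that $$m \|x\|_X \leqslant \|T_s x\|_X \leqslant M \|x\|_X \qquad (x \in X,\ s \in \mathscr{S}).$$ Then there exists a norm $\|\cdot\|_*$ on $X$ such that for any $x \in X$ and $s \in \mathscr{S}$, $m \|x\|_X \leqslant \|x\|_* \leqslant M \|x\|_X$ and $\|T_s x\|_* = \|x\|_*$. If, in addition, the topology of $\mathscr{S}$ is discrete, then there exists a semi-inner product $[\cdot,\cdot]_*$ on $X$ inducing the norm $\|\cdot\|_*$ such that $[T_s x,T_s y]_* = [x,y]_*$ for all $x, y \in X$ and $s \in \mathscr{S}$.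
   Context: An SGT (semigroup with topology) is a non-empty semigroup $\mathscr{S}$ that is also a (possibly non-Hausdorff) topological space; no compatibility between the multiplication and the topology is assumed. For $f:\mathscr{S}\to\mathbb{R}$ and $s\in\mathscr{S}$ let $f_s(t)=f(ts)$. $C_b(\mathscr{S})$ is the space of bounded continuous real-valued functions on $\mathscr{S}$ with the sup-norm, and $C_r(\mathscr{S})=\{f\in C_b(\mathscr{S}): f_s \text{ is continuous for every } s\in\mathscr{S}\}$. Let $C_{norm}(\mathscr{S})$ be the set of all $f\in C_r(\mathscr{S})$ such that $s\mapsto f_s$ and, for all $t\in\mathscr{S}$, $s\mapsto f_{st}$ are continuous from $\mathscr{S}$ to $C_r(\mathscr{S})$ with the norm topology. $\mathscr{S}$ is weakly right amenable if there is a right invariant mean on $C_{norm}(\mathscr{S})$, i.e. a linear functional $\phi:C_{norm}(\mathscr{S})\to\mathbb{R}$ with $\inf f(\mathscr{S})\leqslant\phi(f)\leqslant\sup f(\mathscr{S})$ and $\phi(f_s)=\phi(f)$ for all $f\in C_{norm}(\mathscr{S})$, $s\in\mathscr{S}$. Banach spaces are real or complex. $\mathscr{L}(X)$ is the algebra of bounded linear operators on $X$; $s\mapsto T_s$ is a homomorphism if $T_{st}=T_sT_t$ for all $s,t$. A semi-inner product on a vector space $X$ (in the sense of Lumer) is a scalar-valued function $[\cdot,\cdot]$ on $X\times X$ that is linear in the first variable and satisfies $[x,x]>0$ for $x\neq 0$ and $|[x,y]|^2\leqslant[x,x][y,y]$ for all $x,y\in X$; it induces the norm $\|\cdot\|$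 if $[x,x]=\|x\|^2$ for all $x$. *)

theory Defs
  imports "HOL-Analysis.Analysis"
begin

(* An SGT is a type of sort {semigroup_mult, topological_space}: the two classes are
   independent, so multiplication and topology are unrelated, and the topology need not
   be Hausdorff. *)

definition C_r :: "('s::{semigroup_mult,topological_space} \<Rightarrow>\<^sub>C real) set" where
  "C_r = {f. \<forall>s. continuous_on UNIV (\<lambda>t. apply_bcontfun f (t * s))}"

(* The function f_s as an element of C_b; meaningful for f in C_r only, since otherwise
   f_s may fail to be continuous. *)
definition rtranslate ::
    "('s::{semigroup_mult,topological_space} \<Rightarrow>\<^sub>C real) \<Rightarrow> 's \<Rightarrow> ('s \<Rightarrow>\<^sub>C real)" where
  "rtranslate f s = Bcontfun (\<lambda>t. f (t * s))"

lemma apply_rtranslate: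
  assumes "f \<in> C_r"
  shows "rtranslate f s t = f (t * s)"
proof -
  have "bounded (range (\<lambda>t. f (t * s)))"
    by (rule bounded_subset[OF bounded_apply_bcontfun[of f]]) auto
  then have "(\<lambda>t. f (t * s)) \<in> bcontfun"
    using assms by (auto simp: bcontfun_def C_r_def)
  then show ?thesis
    by (simp add: rtranslate_def Bcontfun_inverse)
qed

definition C_norm :: "('s::{semigroup_mult,topological_space} \<Rightarrow>\<^sub>C real) set" where
  "C_norm = {f \<in> C_r. continuous_on UNIV (\<lambda>s. rtranslate f s) \<and>
                      (\<forall>t. continuous_on UNIV (\<lambda>s. rtranslate f (s * t)))}"

(* Only the values of \<phi> on the subspace C_norm matter. *)
definition right_invariant_mean ::
    "(('s::{semigroup_mult,topological_space} \<Rightarrow>\<^sub>C real) \<Rightarrow> real) \<Rightarrow> bool" where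
  "right_invariant_mean \<phi> \<longleftrightarrow>
     (\<forall>f\<in>C_norm. \<forall>g\<in>C_norm. \<phi> (f + g) = \<phi> f + \<phi> g) \<and>
     (\<forall>c. \<forall>f\<in>C_norm. \<phi> (c *\<^sub>R f) = c * \<phi> f) \<and>
     (\<forall>f\<in>C_norm. (INF t. apply_bcontfun f t) \<le> \<phi> f \<and> \<phi> f \<le> (SUP t. apply_bcontfun f t)) \<and>
     (\<forall>f\<in>C_norm. \<forall>s. \<phi> (rtranslate f s) = \<phi> f)"

definition weakly_right_amenable ::
    "'s::{semigroup_mult,topological_space} itself \<Rightarrow> bool" where
  "weakly_right_amenable _ \<longleftrightarrow>
     (\<exists>\<phi> :: ('s \<Rightarrow>\<^sub>C real) \<Rightarrow> real. right_invariant_mean \<phi>)"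

(* The scalar fields: normed fields isometrically isomorphic to the reals or to the
   complex numbers. *)
class real_or_complex = real_normed_field +
  assumes real_or_complex:
    "\<exists>\<iota> :: 'a \<Rightarrow> complex.
       (\<forall>x y. \<iota> (x + y) = \<iota> x + \<iota> y \<and> \<iota> (x * y) = \<iota> x * \<iota> y) \<and>
       (\<forall>x. cmod (\<iota> x) = norm x) \<and>
       (range \<iota> = \<real> \<or> range \<iota> = UNIV)"

instance real :: real_or_complex
  by standard (rule exI[of _ complex_of_real], auto simp: Reals_def)

instance complex :: real_or_complex
  by standard (rule exI[of _ id], auto)

locale vector_norm = vector_space scale
  for scale :: "'k::real_or_complex \<Rightarrow> 'a::ab_group_add \<Rightarrow> 'a" +
  fixes nrm :: "'a \<Rightarrow> real"
  assumes nonneg: "0 \<le> nrm x"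
    and eq_zero_iff: "nrm x = 0 \<longleftrightarrow> x = 0"
    and triangle: "nrm (x + y) \<le> nrm x + nrm y"
    and homogeneous: "nrm (scale c x) = norm c * nrm x"

(* A Banach space over 'k is a type of class banach, i.e. a real Banach space, whose real
   scalar multiplication is the restriction of a multiplication by 'k for which the norm
   is homogeneous. For 'k = real this forces scale to be scaleR. *)
locale banach_space = vector_norm scale norm
  for scale :: "'k::real_or_complex \<Rightarrow> 'a::banach \<Rightarrow> 'a" +
  assumes scale_of_real: "scale (of_real r) x = r *\<^sub>R x"

(* Lumer's axioms. The scalar field carries no order, so [x,x] > 0 says that [x,x] is the
   image of a positive real, and [x,x], being real and nonnegative, is compared through
   its absolute value. *)
locale semi_inner_product = vector_space scale
  for scale :: "'k::real_or_complex \<Rightarrow> 'a::ab_group_add \<Rightarrow> 'a" +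
  fixes sip :: "'a \<Rightarrow> 'a \<Rightarrow> 'k"
  assumes linear_left: "Vector_Spaces.linear scale (*) (\<lambda>x. sip x y)"
    and positive: "x \<noteq> 0 \<Longrightarrow> \<exists>r>0. sip x x = of_real r"
    and Cauchy_Schwarz: "(norm (sip x y))\<^sup>2 \<le> norm (sip x x) * norm (sip y y)"

definition induces_norm :: "('a \<Rightarrow> 'a \<Rightarrow> 'k::real_or_complex) \<Rightarrow> ('a \<Rightarrow> real) \<Rightarrow> bool" where
  "induces_norm sip nrm \<longleftrightarrow> (\<forall>x. sip x x = of_real ((nrm x)\<^sup>2))"

end

theory Submission
  imports Defs
begin

text \<open>
  The new norm of \<open>x\<close> is the mean, over the semigroup, of the orbit function \<open>s \<mapsto> \<parallel>T\<^sub>s x\<parallel>\<close>. The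
  right translate by \<open>s\<close> of the orbit function of \<open>x\<close> is the orbit function of \<open>T\<^sub>s x\<close>, because
  \<open>T\<close> is a homomorphism. Hence right invariance of the mean says exactly that each \<open>T\<^sub>s\<close> is an
  isometry of the new norm; the norm axioms and the two bounds hold because a mean is linear,
  monotone and lies between the infimum and the supremum. The same translation rule shows that the
  orbit functions belong to \<open>C_norm\<close>: the orbit function is a Lipschitz function of the vector, and
  \<open>s \<mapsto> T\<^sub>s x\<close> is continuous (\<open>orbit_norm_C_norm\<close>, \<open>vector_norm_mean_orbit_norm\<close>).

  If the topology is discrete, every bounded function may be averaged. By Hahn-Banach each \<open>y\<close> has a
  real-linear functional \<open>J y\<close> with \<open>\<bar>J y x\<bar> \<le> \<parallel>y\<parallel> \<parallel>x\<parallel>\<close> and \<open>J y y = \<parallel>y\<parallel>\<^sup>2\<close> for the new norm. Nothing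
  links \<open>J (T\<^sub>s y)\<close> to \<open>J y\<close>, but the mean \<open>g y x\<close> of \<open>s \<mapsto> J (T\<^sub>s y) (T\<^sub>s x)\<close> is invariant, again by
  right invariance, and it inherits linearity in \<open>x\<close>, the bound and the diagonal values since the
  \<open>T\<^sub>s\<close> are isometries. The averaging is thus done with real functionals only; the passage to the
  scalar field replaces each \<open>g y\<close> by the scalar-linear functional with real part \<open>g y\<close>, which has
  the same norm (\<open>norm_linear_extension_le\<close>) and the same value at \<open>y\<close>
  (\<open>linear_extension_attained\<close>).

  Hahn-Banach is obtained from Zorn's lemma applied to sublinear functions instead of to partially
  defined functionals: a minimal sublinear function is linear (\<open>sublinear_ge_linear\<close>), and one that
  lies below a suitable modification of the norm supports it at a given point
  (\<open>sublinear_support\<close>).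
\<close>

section \<open>Supporting functionals of sublinear functions\<close>

definition sublinear :: "('a::real_vector \<Rightarrow> real) \<Rightarrow> bool" where
  "sublinear p \<longleftrightarrow> (\<forall>x y. p (x + y) \<le> p x + p y) \<and> (\<forall>t\<ge>0. \<forall>x. p (t *\<^sub>R x) = t * p x)"

lemma sublinear_zero: "sublinear p \<Longrightarrow> p 0 = 0"
  unfolding sublinear_def by (metis mult_zero_left order_refl scaleR_zero_left)

lemma sublinear_ge: "sublinear p \<Longrightarrow> - p (- x) \<le> p x"
proof -
  assume p: "sublinear p"
  have "p (x + - x) \<le> p x + p (- x)" using p unfolding sublinear_def by blast
  then show ?thesis using sublinear_zero[OF p] by simp
qed

text \<open>The inequality suffices, since applying it to the factor \<open>1 / t\<close> gives its converse.\<close>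
lemma sublinearI:
  assumes add: "\<And>x y. p (x + y) \<le> p x + p y"
    and zero: "p 0 = 0"
    and scale: "\<And>t x. t > 0 \<Longrightarrow> p (t *\<^sub>R x) \<le> t * p x"
  shows "sublinear p"
  unfolding sublinear_def
proof (intro conjI allI impI)
  fix t :: real and x assume "t \<ge> 0"
  show "p (t *\<^sub>R x) = t * p x"
  proof (cases "t = 0")
    case False
    then have t: "t > 0" using \<open>t \<ge> 0\<close> by simp
    have "p ((1 / t) *\<^sub>R (t *\<^sub>R x)) \<le> (1 / t) * p (t *\<^sub>R x)"
      by (rule scale) (use t in simp)
    then have "t * p x \<le> p (t *\<^sub>R x)" using t by (simp add: field_simps)
    then show ?thesis using scale[OF t, of x] by simp
  qed (simp add: zero)
qed (rule add)

text \<open>The largest sublinear function below \<open>p\<close> whose value at \<open>- y\<close> is at most \<open>- p y\<close>. It agrees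
  with \<open>p\<close> for every \<open>y\<close> exactly when \<open>p\<close> is linear.\<close>
definition tilt :: "('a::real_vector \<Rightarrow> real) \<Rightarrow> 'a \<Rightarrow> 'a \<Rightarrow> real" where
  "tilt p y x = (INF t\<in>{0..}. p (x + t *\<^sub>R y) - t * p y)"

lemma tilt_le:
  assumes p: "sublinear p" and "t \<ge> 0"
  shows "tilt p y x \<le> p (x + t *\<^sub>R y) - t * p y"
  unfolding tilt_def
proof (rule cINF_lower)
  show "bdd_below ((\<lambda>t. p (x + t *\<^sub>R y) - t * p y) ` {0..})"
  proof (rule bdd_belowI2)
    fix t :: real assume t: "t \<in> {0..}"
    have "p ((x + t *\<^sub>R y) + - x) \<le> p (x + t *\<^sub>R y) + p (- x)"
      using p unfolding sublinear_def by blast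
    moreover have "p (t *\<^sub>R y) = t * p y" using p t unfolding sublinear_def by simp
    ultimately show "- p (- x) \<le> p (x + t *\<^sub>R y) - t * p y" by simp
  qed
qed (use assms in simp)

lemma tilt_greatest:
  assumes "\<And>t. t \<ge> 0 \<Longrightarrow> c \<le> p (x + t *\<^sub>R y) - t * p y"
  shows "c \<le> tilt p y x"
  unfolding tilt_def by (rule cINF_greatest) (use assms in auto)

lemma tilt_below: "sublinear p \<Longrightarrow> tilt p y x \<le> p x"
  using tilt_le[of p 0 y x] by simp

lemma sublinear_tilt:
  assumes p: "sublinear p"
  shows "sublinear (tilt p y)"
proof (rule sublinearI)
  fix x z
  have split: "tilt p y (x + z) \<le> (p (x + s *\<^sub>R y) - s * p y) + (p (z + t *\<^sub>R y) - t * p y)"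
    if "s \<ge> 0" "t \<ge> 0" for s t
  proof -
    have "tilt p y (x + z) \<le> p (x + z + (s + t) *\<^sub>R y) - (s + t) * p y"
      by (rule tilt_le[OF p]) (use that in simp)
    also have "x + z + (s + t) *\<^sub>R y = (x + s *\<^sub>R y) + (z + t *\<^sub>R y)"
      by (simp add: algebra_simps)
    also have "p \<dots> \<le> p (x + s *\<^sub>R y) + p (z + t *\<^sub>R y)"
      using p unfolding sublinear_def by blast
    finally show ?thesis by (simp add: algebra_simps)
  qed
  have "tilt p y (x + z) - (p (x + s *\<^sub>R y) - s * p y) \<le> tilt p y z" if "s \<ge> 0" for s
  proof (rule tilt_greatest)
    fix t :: real assume "t \<ge> 0"
    with split[OF that this] show "tilt p y (x + z) - (p (x + s *\<^sub>R y) - s * p y)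
        \<le> p (z + t *\<^sub>R y) - t * p y" by linarith
  qed
  then have "tilt p y (x + z) - tilt p y z \<le> tilt p y x"
    by (intro tilt_greatest) (simp add: algebra_simps)
  then show "tilt p y (x + z) \<le> tilt p y x + tilt p y z" by simp
next
  have "0 \<le> tilt p y 0"
    by (rule tilt_greatest) (use p in \<open>simp add: sublinear_def\<close>)
  then show "tilt p y 0 = 0"
    using tilt_below[OF p, of y 0] sublinear_zero[OF p] by simp
next
  fix c :: real and x assume c: "c > 0"
  have "tilt p y (c *\<^sub>R x) / c \<le> tilt p y x"
  proof (rule tilt_greatest)
    fix t :: real assume t: "t \<ge> 0"
    have "tilt p y (c *\<^sub>R x) \<le> p (c *\<^sub>R x + (c * t) *\<^sub>R y) - (c * t) * p y"
      by (rule tilt_le[OF p]) (use c t in simp)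
    also have "c *\<^sub>R x + (c * t) *\<^sub>R y = c *\<^sub>R (x + t *\<^sub>R y)" by (simp add: algebra_simps)
    also have "p \<dots> = c * p (x + t *\<^sub>R y)"
      using p c unfolding sublinear_def by simp
    finally show "tilt p y (c *\<^sub>R x) / c \<le> p (x + t *\<^sub>R y) - t * p y"
      using c by (simp add: field_simps)
  qed
  then show "tilt p y (c *\<^sub>R x) \<le> c * tilt p y x" using c by (simp add: field_simps)
qed

text \<open>A chain of sublinear functions below \<open>p\<close> cannot descend to \<open>-\<infinity>\<close>, because each member is at
  least \<open>- p (- x)\<close> at \<open>x\<close>. The infimum is subadditive because any two members of the chain lie
  above a common one.\<close>
lemma sublinear_chain_INF:
  fixes p :: "'a::real_vector \<Rightarrow> real"
  assumes ne: "C \<noteq> {}"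
    and C: "\<And>q. q \<in> C \<Longrightarrow> sublinear q \<and> q \<le> p"
    and chain: "\<And>q r. q \<in> C \<Longrightarrow> r \<in> C \<Longrightarrow> q \<le> r \<or> r \<le> q"
  defines "l \<equiv> \<lambda>x. INF q\<in>C. q x"
  shows "sublinear l" and "\<And>q. q \<in> C \<Longrightarrow> l \<le> q"
proof -
  have lower: "l x \<le> q x" if "q \<in> C" for q x
    unfolding l_def
  proof (rule cINF_lower)
    show "bdd_below ((\<lambda>q. q x) ` C)"
    proof (rule bdd_belowI2)
      fix q assume "q \<in> C"
      then have "- q (- x) \<le> q x" "q (- x) \<le> p (- x)"
        using C sublinear_ge by (auto simp: le_fun_def)
      then show "- p (- x) \<le> q x" by simp
    qed
  qed (rule that)
  have greatest: "c \<le> l x" if "\<And>q. q \<in> C \<Longrightarrow> c \<le> q x" for c x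
    unfolding l_def by (rule cINF_greatest[OF ne]) (rule that)
  show "l \<le> q" if "q \<in> C" for q using lower[OF that] by (simp add: le_fun_def)
  show "sublinear l"
  proof (rule sublinearI)
    fix x z
    have sum: "l (x + z) \<le> q x + r z" if qr: "q \<in> C" "r \<in> C" for q r
    proof -
      obtain s where s: "s \<in> C" "s \<le> q" "s \<le> r" using chain[OF qr] qr by blast
      have "l (x + z) \<le> s (x + z)" by (rule lower[OF s(1)])
      also have "\<dots> \<le> s x + s z" using C[OF s(1)] unfolding sublinear_def by blast
      also have "\<dots> \<le> q x + r z" using s by (simp add: add_mono le_fun_def)
      finally show ?thesis .
    qed
    have "l (x + z) - q x \<le> l z" if "q \<in> C" for q
      by (rule greatest) (use sum[OF that] in \<open>simp add: algebra_simps\<close>)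
    then have "l (x + z) - l z \<le> l x"
      by (intro greatest) (simp add: algebra_simps)
    then show "l (x + z) \<le> l x + l z" by simp
  next
    have "q 0 = 0" if "q \<in> C" for q using C[OF that] sublinear_zero by blast
    then have "(\<lambda>q. q 0) ` C = {0}" using ne by force
    then show "l 0 = 0" by (simp add: l_def)
  next
    fix t :: real and x assume t: "t > 0"
    have "l (t *\<^sub>R x) / t \<le> l x"
    proof (rule greatest)
      fix q assume q: "q \<in> C"
      have "q (t *\<^sub>R x) = t * q x" using C[OF q] t unfolding sublinear_def by simp
      then show "l (t *\<^sub>R x) / t \<le> q x" using lower[OF q, of "t *\<^sub>R x"] t by (simp add: field_simps)
    qed
    then show "l (t *\<^sub>R x) \<le> t * l x" using t by (simp add: field_simps)
  qed
qed

text \<open>A minimal sublinear function is unchanged by every tilt; this says that it is superadditive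
  too, hence linear.\<close>
lemma sublinear_ge_linear:
  fixes p :: "'a::real_vector \<Rightarrow> real"
  assumes p: "sublinear p"
  obtains f where "linear f" "f \<le> p"
proof -
  define A where "A = {q. sublinear q \<and> q \<le> p}"
  have "\<exists>f\<in>A. \<forall>q\<in>A. f \<ge> q \<longrightarrow> q = f"
  proof (rule predicate_Zorn)
    show "partial_order_on A (relation_of (\<lambda>q r. q \<ge> r) A)"
      by (rule partial_order_on_relation_ofI) auto
    fix C assume C: "C \<in> Chains (relation_of (\<lambda>q r. q \<ge> r) A)"
    show "\<exists>l\<in>A. \<forall>q\<in>C. q \<ge> l"
    proof (cases "C = {}")
      case True
      then show ?thesis using p by (auto simp: A_def)
    next
      case False
      have CA: "sublinear q \<and> q \<le> p" if "q \<in> C" for q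
        using C that by (auto simp: Chains_def relation_of_def A_def)
      have chain: "q \<le> r \<or> r \<le> q" if "q \<in> C" "r \<in> C" for q r
        using C that by (auto simp: Chains_def relation_of_def)
      note l = sublinear_chain_INF[OF False CA chain]
      obtain q where "q \<in> C" using False by blast
      then have "(\<lambda>x. INF q\<in>C. q x) \<in> A"
        unfolding A_def using l CA order_trans by blast
      then show ?thesis using l(2) by blast
    qed
  qed
  then obtain f where f: "sublinear f" "f \<le> p"
    and minimal: "\<And>q. sublinear q \<Longrightarrow> q \<le> f \<Longrightarrow> q = f"
    unfolding A_def by (auto intro: order_trans)
  \<comment> \<open>The tilt at \<open>y\<close>, taken with \<open>t = 1\<close>, gives the inequality that sublinearity lacks.\<close>
  have add: "f (x + y) = f x + f y" for x y
  proof (rule antisym)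
    have "tilt f y = f"
      by (rule minimal[OF sublinear_tilt[OF f(1)]]) (simp add: le_fun_def tilt_below[OF f(1)])
    then show "f x + f y \<le> f (x + y)" using tilt_le[OF f(1), of 1 y x] by simp
  qed (use f in \<open>simp add: sublinear_def\<close>)
  have minus: "f (- x) = - f x" for x
    using add[of x "- x"] sublinear_zero[OF f(1)] by simp
  have "linear f"
  proof (rule linearI)
    fix r x
    show "f (r *\<^sub>R x) = r *\<^sub>R f x"
    proof (cases "r \<ge> 0")
      case True
      then show ?thesis using f(1) by (simp add: sublinear_def)
    next
      case False
      then have "f ((- r) *\<^sub>R x) = (- r) * f x"
        using f(1) unfolding sublinear_def by (metis neg_0_le_iff_le nle_le)
      then show ?thesis using minus[of "r *\<^sub>R x"] by simp
    qed
  qed (rule add)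
  then show ?thesis using that f by blast
qed

text \<open>A linear function below the tilt of \<open>p\<close> at \<open>y\<close> is at most \<open>- p y\<close> at \<open>- y\<close>, so it reaches
  \<open>p\<close> at \<open>y\<close>.\<close>
lemma sublinear_support:
  fixes p :: "'a::real_vector \<Rightarrow> real"
  assumes p: "sublinear p"
  obtains f where "linear f" "f \<le> p" "f y = p y"
proof -
  obtain f where f: "linear f" "f \<le> tilt p y"
    using sublinear_ge_linear[OF sublinear_tilt[OF p]] by blast
  have le: "f \<le> p" using f(2) tilt_below[OF p] order_trans unfolding le_fun_def by blast
  have "f (- y) \<le> - p y"
    using f(2) tilt_le[OF p, of 1 y "- y"] sublinear_zero[OF p]
    unfolding le_fun_def by (force intro: order_trans)
  then have "p y \<le> f y" using linear_neg[OF f(1)] by simp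
  with le have "f y = p y" by (simp add: le_fun_def antisym)
  with f(1) le show ?thesis by (rule that)
qed

section \<open>Scalars and linear extension of real functionals\<close>

text \<open>Taking \<open>e = 0\<close> for real scalars and \<open>e\<close> a square root of \<open>-1\<close> for complex ones lets both cases
  share the same formulas.\<close>
definition is_imaginary_unit :: "'k::real_or_complex \<Rightarrow> bool" where
  "is_imaginary_unit e \<longleftrightarrow> (e = 0 \<or> e * e = -1) \<and>
     (\<forall>a b. (norm (of_real a + e * of_real b))\<^sup>2 = a\<^sup>2 + b\<^sup>2 * (norm e)\<^sup>2) \<and>
     (\<forall>k. \<exists>a b. k = of_real a + e * of_real b)"

lemma imaginary_unit_exists: "\<exists>e :: 'k::real_or_complex. is_imaginary_unit e"
proof -
  obtain \<iota> :: "'k \<Rightarrow> complex" where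
    hom: "\<And>x y. \<iota> (x + y) = \<iota> x + \<iota> y" "\<And>x y. \<iota> (x * y) = \<iota> x * \<iota> y"
    and iso: "\<And>x. cmod (\<iota> x) = norm x" and range: "range \<iota> = \<real> \<or> range \<iota> = UNIV"
    using real_or_complex[where 'a = 'k] by blast
  have add: "Modules.additive \<iota>" by (rule Modules.additive.intro) (rule hom(1))
  have inj: "x = y" if "\<iota> x = \<iota> y" for x y
    using iso[of "x - y"] Modules.additive.diff[OF add, of x y] that by simp
  have one: "\<iota> 1 = 1"
  proof -
    have "\<iota> 1 * \<iota> 1 = \<iota> 1" using hom(2)[of 1 1] by simp
    moreover have "\<iota> 1 \<noteq> 0" using iso[of 1] by auto
    ultimately show ?thesis by simp
  qed
  \<comment> \<open>A complex number is determined to be the real \<open>r\<close> by its distances to \<open>0\<close> and \<open>1\<close>, which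
    \<open>\<iota>\<close> preserves.\<close>
  have of_real: "\<iota> (of_real r) = of_real r" for r
  proof -
    define z where "z = \<iota> (of_real r)"
    have "cmod z = \<bar>r\<bar>" by (simp add: z_def iso)
    moreover have "cmod (z - 1) = \<bar>r - 1\<bar>"
    proof -
      have "z - 1 = \<iota> (of_real (r - 1))"
        using Modules.additive.diff[OF add, of "of_real r" 1] by (simp add: z_def one)
      then show ?thesis by (simp only: iso norm_of_real)
    qed
    ultimately have "(cmod z)\<^sup>2 = r\<^sup>2" "(cmod (z - 1))\<^sup>2 = (r - 1)\<^sup>2" by simp_all
    then have eq: "(Re z)\<^sup>2 + (Im z)\<^sup>2 = r\<^sup>2" "(Re z - 1)\<^sup>2 + (Im z)\<^sup>2 = (r - 1)\<^sup>2"
      by (simp_all add: cmod_power2)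
    then have "Re z = r" by (simp add: power2_diff)
    with eq(1) have "Im z = 0" by simp
    with \<open>Re z = r\<close> show ?thesis by (simp add: complex_eq_iff z_def)
  qed
  from range show ?thesis
  proof
    assume R: "range \<iota> = \<real>"
    have "\<exists>a. k = of_real a" for k :: 'k
    proof -
      have "\<iota> k \<in> \<real>" using R by blast
      then obtain a where "\<iota> k = of_real a" by (auto elim: Reals_cases)
      then have "\<iota> k = \<iota> (of_real a)" by (simp add: of_real)
      then show ?thesis using inj by blast
    qed
    then have "is_imaginary_unit (0::'k)"
      by (simp add: is_imaginary_unit_def)
    then show ?thesis ..
  next
    assume "range \<iota> = UNIV"
    then obtain e where e: "\<iota> e = \<i>" by (metis surjD)
    have comb: "\<iota> (of_real a + e * of_real b) = Complex a b" for a b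
      by (simp add: hom of_real e complex_eq_iff)
    have "\<iota> (e * e) = \<iota> (of_real (-1))" unfolding of_real by (simp add: hom e)
    then have sq: "e * e = -1" using inj by fastforce
    have "norm e = 1" using iso[of e] e by simp
    then have nrm: "(norm (of_real a + e * of_real b))\<^sup>2 = a\<^sup>2 + b\<^sup>2 * (norm e)\<^sup>2" for a b
      by (simp only: iso[symmetric] comb) (simp add: cmod_power2 e)
    have "\<exists>a b. k = of_real a + e * of_real b" for k
      using inj[of k "of_real (Re (\<iota> k)) + e * of_real (Im (\<iota> k))"] comb by (metis complex_surj)
    with sq nrm have "is_imaginary_unit e" unfolding is_imaginary_unit_def by blast
    then show ?thesis ..
  qed
qed

text \<open>The norm condition forces \<open>1\<close> and \<open>e\<close> to be orthogonal, so real parts are determined.\<close>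
lemma imaginary_unit_real_part:
  fixes e :: "'k::real_or_complex"
  assumes e: "is_imaginary_unit e" and eq: "of_real a - e * of_real b = (of_real c :: 'k)"
  shows "a = c"
proof -
  have "of_real (a - c) + e * of_real (- b) = (0 :: 'k)"
    using eq by (simp add: algebra_simps)
  moreover have "(norm (of_real (a - c) + e * of_real (- b)))\<^sup>2 = (a - c)\<^sup>2 + (- b)\<^sup>2 * (norm e)\<^sup>2"
    using e unfolding is_imaginary_unit_def by blast
  ultimately have "(a - c)\<^sup>2 + (- b)\<^sup>2 * (norm e)\<^sup>2 = 0" by simp
  then have "(a - c)\<^sup>2 = 0"
    by (metis add_nonneg_eq_0_iff zero_le_mult_iff zero_le_power2)
  then show ?thesis by simp
qed

text \<open>The scalar-linear functional whose real part is the real-linear functional \<open>g\<close>.\<close>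
definition linear_extension ::
    "'k::real_or_complex \<Rightarrow> ('k \<Rightarrow> 'a \<Rightarrow> 'a) \<Rightarrow> ('a::real_vector \<Rightarrow> real) \<Rightarrow> 'a \<Rightarrow> 'k" where
  "linear_extension e sc g x = of_real (g x) - e * of_real (g (sc e x))"

lemma linear_linear_extension:
  fixes scale :: "'k::real_or_complex \<Rightarrow> 'a::real_vector \<Rightarrow> 'a"
  assumes V: "vector_space scale" and R: "\<And>r x. scale (of_real r) x = r *\<^sub>R x"
    and e: "is_imaginary_unit e" and g: "linear g"
  shows "Vector_Spaces.linear scale (*) (linear_extension e scale g)"
proof -
  interpret vector_space scale by (rule V)
  have "linear_extension e scale g (scale k x) = k * linear_extension e scale g x" for k x
  proof -
    obtain a b where k: "k = of_real a + e * of_real b"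
      using e unfolding is_imaginary_unit_def by blast
    have kx: "scale k x = a *\<^sub>R x + b *\<^sub>R scale e x"
      by (simp add: k scale_left_distrib R[symmetric] mult.commute[of e])
    have g1: "g (scale k x) = a * g x + b * g (scale e x)"
      by (simp add: kx linear_add[OF g] linear_scale[OF g])
    have "scale e (scale k x) = a *\<^sub>R scale e x + b *\<^sub>R scale (e * e) x"
      by (simp add: kx scale_right_distrib R[symmetric] ac_simps)
    then have g2: "g (scale e (scale k x)) = a * g (scale e x) + b * g (scale (e * e) x)"
      by (simp add: linear_add[OF g] linear_scale[OF g])
    consider "e = 0" | "e * e = -1" using e unfolding is_imaginary_unit_def by blast
    then show ?thesis
    proof cases
      case 1
      then show ?thesis using g1 by (simp add: linear_extension_def k linear_0[OF g])
    next
      case 2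
      have "g (scale (e * e) x) = - g x" by (simp add: 2 linear_neg[OF g])
      then have "linear_extension e scale g (scale k x) - k * linear_extension e scale g x
          = (of_real b * of_real (g (scale e x))) * (1 + e * e)"
        unfolding linear_extension_def g1 g2 \<open>g (scale (e * e) x) = - g x\<close> unfolding k
        by (simp add: algebra_simps)
      then show ?thesis by (simp add: 2)
    qed
  qed
  moreover have "linear_extension e scale g (x + y)
      = linear_extension e scale g x + linear_extension e scale g y" for x y
    by (simp add: linear_extension_def linear_add[OF g] scale_right_distrib algebra_simps)
  moreover have "vector_space ((*) :: 'k \<Rightarrow> 'k \<Rightarrow> 'k)"
    by unfold_locales (auto simp: algebra_simps)
  ultimately show ?thesis using V by (simp add: Vector_Spaces.linear_iff)
qed

text \<open>Rotating \<open>x\<close> by a scalar of modulus one makes the value of the extension real, where it is the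
  value of \<open>g\<close>.\<close>
lemma norm_linear_extension_le:
  fixes scale :: "'k::real_or_complex \<Rightarrow> 'a::real_vector \<Rightarrow> 'a"
  assumes N: "vector_norm scale nrm" and R: "\<And>r x. scale (of_real r) x = r *\<^sub>R x"
    and e: "is_imaginary_unit e" and g: "linear g" and le: "\<And>x. g x \<le> c * nrm x"
  shows "norm (linear_extension e scale g x) \<le> c * nrm x"
proof -
  interpret vector_norm scale nrm by (rule N)
  define z where "z = linear_extension e scale g x"
  \<comment> \<open>\<open>u\<close> has modulus one and turns \<open>z\<close> into \<open>\<bar>z\<bar>\<close>.\<close>
  define u where "u = (if z = 0 then 1 else of_real (norm z) / z)"
  have u: "norm u = 1" "u * z = of_real (norm z)" by (auto simp: u_def norm_divide)
  have "linear_extension e scale g (scale u x) = u * z"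
    using linear_linear_extension[OF vector_space_axioms R e g]
    by (simp add: Vector_Spaces.linear_iff z_def)
  then have "g (scale u x) = norm z"
    unfolding u(2) linear_extension_def by (rule imaginary_unit_real_part[OF e])
  then show ?thesis using le[of "scale u x"] by (simp add: homogeneous u z_def)
qed

text \<open>The extension has modulus at most \<open>g x\<close> at \<open>x\<close>, and \<open>g x\<close> is its real part, which leaves no room
  for an imaginary part.\<close>
lemma linear_extension_attained:
  fixes scale :: "'k::real_or_complex \<Rightarrow> 'a::real_vector \<Rightarrow> 'a"
  assumes N: "vector_norm scale nrm" and R: "\<And>r x. scale (of_real r) x = r *\<^sub>R x"
    and e: "is_imaginary_unit e" and g: "linear g" and le: "\<And>x. g x \<le> c * nrm x"
    and eq: "g x = c * nrm x"
  shows "linear_extension e scale g x = of_real (g x)"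
proof -
  define b where "b = g (scale e x)"
  have "(norm (of_real (g x) + e * of_real (- b)))\<^sup>2 = (g x)\<^sup>2 + (- b)\<^sup>2 * (norm e)\<^sup>2"
    using e unfolding is_imaginary_unit_def by blast
  moreover have "norm (of_real (g x) + e * of_real (- b)) \<le> g x"
    using norm_linear_extension_le[OF N R e g le, of x] eq
    by (simp add: linear_extension_def b_def)
  then have "(norm (of_real (g x) + e * of_real (- b)))\<^sup>2 \<le> (g x)\<^sup>2"
    by (rule power_mono) simp
  ultimately have "(b * norm e)\<^sup>2 \<le> 0" by (simp add: power_mult_distrib)
  then have "e * of_real b = 0" by auto
  then show ?thesis by (simp add: linear_extension_def b_def)
qed

section \<open>Invariant means\<close>

text \<open>Right translation is linear on \<open>C_r\<close>, so \<open>C_norm\<close> is a linear subspace. This is what makes a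
  mean monotone, by applying it to a difference.\<close>
lemma C_norm_add:
  assumes f: "f \<in> C_norm" and g: "g \<in> C_norm"
  shows "f + g \<in> C_norm"
proof -
  have r: "f \<in> C_r" "g \<in> C_r" using f g by (auto simp: C_norm_def)
  have fg: "f + g \<in> C_r" using r by (auto simp: C_r_def intro!: continuous_intros)
  have "rtranslate (f + g) s = rtranslate f s + rtranslate g s" for s
    by (rule bcontfun_eqI) (simp add: apply_rtranslate r fg)
  then show ?thesis using f g fg by (auto simp: C_norm_def intro!: continuous_intros)
qed

lemma C_norm_scaleR:
  assumes f: "f \<in> C_norm"
  shows "c *\<^sub>R f \<in> C_norm"
proof -
  have r: "f \<in> C_r" using f by (auto simp: C_norm_def)
  have cf: "c *\<^sub>R f \<in> C_r" using r by (auto simp: C_r_def intro!: continuous_intros)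
  have "rtranslate (c *\<^sub>R f) s = c *\<^sub>R rtranslate f s" for s
    by (rule bcontfun_eqI) (simp add: apply_rtranslate r cf)
  then show ?thesis using f cf by (auto simp: C_norm_def intro!: continuous_intros)
qed

lemma mean_le:
  assumes "right_invariant_mean \<phi>" "f \<in> C_norm" "\<And>t. apply_bcontfun f t \<le> c"
  shows "\<phi> f \<le> c"
proof -
  have "(SUP t. apply_bcontfun f t) \<le> c" by (rule cSUP_least) (use assms in auto)
  then show ?thesis using assms unfolding right_invariant_mean_def by (meson order_trans)
qed

lemma mean_ge:
  assumes "right_invariant_mean \<phi>" "f \<in> C_norm" "\<And>t. c \<le> apply_bcontfun f t"
  shows "c \<le> \<phi> f"
proof -
  have "c \<le> (INF t. apply_bcontfun f t)" by (rule cINF_greatest) (use assms in auto)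
  then show ?thesis using assms unfolding right_invariant_mean_def by (meson order_trans)
qed

lemma mean_add:
  "right_invariant_mean \<phi> \<Longrightarrow> f \<in> C_norm \<Longrightarrow> g \<in> C_norm \<Longrightarrow> \<phi> (f + g) = \<phi> f + \<phi> g"
  unfolding right_invariant_mean_def by blast

lemma mean_scaleR: "right_invariant_mean \<phi> \<Longrightarrow> f \<in> C_norm \<Longrightarrow> \<phi> (c *\<^sub>R f) = c * \<phi> f"
  unfolding right_invariant_mean_def by blast

lemma mean_rtranslate: "right_invariant_mean \<phi> \<Longrightarrow> f \<in> C_norm \<Longrightarrow> \<phi> (rtranslate f s) = \<phi> f"
  unfolding right_invariant_mean_def by blast

lemma mean_mono:
  assumes \<phi>: "right_invariant_mean \<phi>" and f: "f \<in> C_norm" and g: "g \<in> C_norm"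
    and le: "\<And>t. apply_bcontfun f t \<le> apply_bcontfun g t"
  shows "\<phi> f \<le> \<phi> g"
proof -
  have "0 \<le> \<phi> (g + (-1) *\<^sub>R f)"
    by (rule mean_ge[OF \<phi> C_norm_add[OF g C_norm_scaleR[OF f]]]) (simp add: le)
  then show ?thesis
    using mean_add[OF \<phi> g C_norm_scaleR[OF f, of "-1"]] mean_scaleR[OF \<phi> f, of "-1"] by simp
qed

lemma discrete_continuous_on:
  assumes "(euclidean :: 's::topological_space topology) = discrete_topology UNIV"
  shows "continuous_on UNIV (f :: 's \<Rightarrow> 'b::topological_space)"
proof -
  have "open S" for S :: "'s set"
    using assms openin_discrete_topology[of UNIV S] by (simp add: open_openin)
  then show ?thesis by (simp add: continuous_on_open_vimage)
qed

text \<open>Over a discrete space each continuity requirement in \<open>C_norm\<close> holds trivially.\<close>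
lemma discrete_C_norm:
  assumes "(euclidean :: 's::{semigroup_mult,topological_space} topology) = discrete_topology UNIV"
  shows "(f :: 's \<Rightarrow>\<^sub>C real) \<in> C_norm"
  by (auto simp: C_norm_def C_r_def intro!: discrete_continuous_on[OF assms])

section \<open>The invariant norm\<close>

definition orbit_norm ::
    "('s::topological_space \<Rightarrow> ('a::real_normed_vector \<Rightarrow>\<^sub>L 'a)) \<Rightarrow> 'a \<Rightarrow> ('s \<Rightarrow>\<^sub>C real)" where
  "orbit_norm T x = Bcontfun (\<lambda>s. norm (T s x))"

text \<open>Both maps required to be continuous for membership in \<open>C_norm\<close> have the form
  \<open>s \<mapsto> orbit_norm T (T s y)\<close>, with \<open>y = x\<close> and \<open>y = T t x\<close>.\<close>
lemma orbit_norm: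
  fixes T :: "'s::{semigroup_mult,topological_space} \<Rightarrow> ('a::real_normed_vector \<Rightarrow>\<^sub>L 'a)"
  assumes hom: "\<And>s t. T (s * t) = T s o\<^sub>L T t"
    and cont: "continuous_map euclidean strong_operator_topology T"
    and bound: "\<And>s x. norm (T s x) \<le> M * norm x"
  shows apply_orbit_norm: "apply_bcontfun (orbit_norm T x) s = norm (T s x)"
    and rtranslate_orbit_norm: "rtranslate (orbit_norm T x) s = orbit_norm T (T s x)"
    and orbit_norm_C_norm: "orbit_norm T x \<in> C_norm"
proof -
  have orbit: "continuous_on UNIV (\<lambda>s. T s x)" for x
    using cont by (simp add: continuous_on_strong_operator_topo_iff_coordinatewise)
  have app: "apply_bcontfun (orbit_norm T x) s = norm (T s x)" for x s
  proof -
    have "(\<lambda>s. norm (T s x)) \<in> bcontfun"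
      by (rule bcontfun_normI[where b = "M * norm x"])
        (auto intro!: continuous_intros orbit bound)
    then show ?thesis by (simp add: orbit_norm_def Bcontfun_inverse)
  qed
  then show "apply_bcontfun (orbit_norm T x) s = norm (T s x)" .
  have C_r: "orbit_norm T x \<in> C_r" for x
    by (simp add: C_r_def app hom continuous_on_norm[OF orbit])
  have trans: "rtranslate (orbit_norm T x) s = orbit_norm T (T s x)" for x s
    by (rule bcontfun_eqI) (simp add: apply_rtranslate[OF C_r] app hom)
  then show "rtranslate (orbit_norm T x) s = orbit_norm T (T s x)" .
  have "\<bar>M\<bar>-lipschitz_on UNIV (orbit_norm T)"
  proof (rule lipschitz_onI)
    fix x y
    show "dist (orbit_norm T x) (orbit_norm T y) \<le> \<bar>M\<bar> * dist x y"
    proof (rule dist_bound)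
      fix s
      have "\<bar>norm (T s x) - norm (T s y)\<bar> \<le> norm (T s (x - y))"
        by (simp add: blinfun.diff_right norm_triangle_ineq3)
      also have "\<dots> \<le> M * dist x y" using bound by (simp add: dist_norm)
      also have "\<dots> \<le> \<bar>M\<bar> * dist x y" by (intro mult_right_mono) auto
      finally show "dist (orbit_norm T x s) (orbit_norm T y s) \<le> \<bar>M\<bar> * dist x y"
        by (simp add: app dist_real_def)
    qed
  qed simp
  then have lip: "continuous_on UNIV (orbit_norm T)" by (rule lipschitz_on_continuous_on)
  have "continuous_on UNIV (\<lambda>s. orbit_norm T (T s y))" for y
    by (rule continuous_on_compose2[OF lip orbit]) simp
  then show "orbit_norm T x \<in> C_norm"
    by (simp add: C_norm_def C_r trans hom)
qed

text \<open>The lower bound on the \<open>T s\<close> makes the mean definite; the other norm axioms pass from the orbit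
  functions to their mean.\<close>
lemma vector_norm_mean_orbit_norm:
  fixes scale :: "'k::real_or_complex \<Rightarrow> 'a::real_normed_vector \<Rightarrow> 'a"
    and T :: "'s::{semigroup_mult,topological_space} \<Rightarrow> ('a \<Rightarrow>\<^sub>L 'a)"
  assumes norm: "vector_norm scale norm"
    and linear: "\<And>s. Vector_Spaces.linear scale scale (blinfun_apply (T s))"
    and hom: "\<And>s t. T (s * t) = T s o\<^sub>L T t"
    and cont: "continuous_map euclidean strong_operator_topology T"
    and bound: "\<And>s x. norm (T s x) \<le> M * norm x"
    and m: "m > 0" and below: "\<And>s x. m * norm x \<le> norm (T s x)"
    and \<phi>: "right_invariant_mean \<phi>"
  shows "vector_norm scale (\<lambda>x. \<phi> (orbit_norm T x))"
    and "\<phi> (orbit_norm T (T s x)) = \<phi> (orbit_norm T x)"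
    and "m * norm x \<le> \<phi> (orbit_norm T x)" and "\<phi> (orbit_norm T x) \<le> M * norm x"
proof -
  interpret vector_norm scale norm by (rule norm)
  note app = apply_orbit_norm[of T, OF hom cont bound]
  note C = orbit_norm_C_norm[of T, OF hom cont bound]
  show "\<phi> (orbit_norm T (T s x)) = \<phi> (orbit_norm T x)"
    using mean_rtranslate[OF \<phi> C, of x s] rtranslate_orbit_norm[of T, OF hom cont bound, of x s]
    by simp
  show lower: "m * norm x \<le> \<phi> (orbit_norm T x)" for x
    by (rule mean_ge[OF \<phi> C]) (simp add: app below)
  show "\<phi> (orbit_norm T x) \<le> M * norm x"
    by (rule mean_le[OF \<phi> C]) (simp add: app bound)
  have homog: "\<phi> (orbit_norm T (scale c x)) = norm c * \<phi> (orbit_norm T x)" for c x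
  proof -
    have "orbit_norm T (scale c x) = norm c *\<^sub>R orbit_norm T x"
      by (rule bcontfun_eqI)
        (use linear in \<open>simp add: app homogeneous Vector_Spaces.linear_iff\<close>)
    then show ?thesis by (simp add: mean_scaleR[OF \<phi> C])
  qed
  show "vector_norm scale (\<lambda>x. \<phi> (orbit_norm T x))"
  proof (unfold_locales)
    fix x y :: 'a and c :: 'k
    have "0 \<le> m * norm x" using m by simp
    then show "0 \<le> \<phi> (orbit_norm T x)" using lower[of x] by linarith
    show "\<phi> (orbit_norm T (scale c x)) = norm c * \<phi> (orbit_norm T x)" by (rule homog)
    show "\<phi> (orbit_norm T x) = 0 \<longleftrightarrow> x = 0"
    proof
      assume "\<phi> (orbit_norm T x) = 0"
      then have "m * norm x \<le> 0" using lower[of x] by simp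
      then show "x = 0" using m by (simp add: mult_le_0_iff)
    next
      assume "x = 0"
      then show "\<phi> (orbit_norm T x) = 0" using homog[of 0 x] by simp
    qed
    have "\<phi> (orbit_norm T (x + y)) \<le> \<phi> (orbit_norm T x + orbit_norm T y)"
      by (rule mean_mono[OF \<phi> C C_norm_add[OF C C]])
        (simp add: app blinfun.add_right norm_triangle_ineq)
    then show "\<phi> (orbit_norm T (x + y)) \<le> \<phi> (orbit_norm T x) + \<phi> (orbit_norm T y)"
      by (simp add: mean_add[OF \<phi> C C])
  qed
qed

section \<open>The invariant semi-inner product\<close>

text \<open>\<open>J y\<close> is \<open>nrm y\<close> times a functional supporting the norm at \<open>y\<close>. The choice of \<open>J y\<close> is arbitrary,
  so \<open>J\<close> need not respect any isometry; averaging repairs this.\<close>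
lemma norm_duality_selection:
  fixes scale :: "'k::real_or_complex \<Rightarrow> 'a::real_vector \<Rightarrow> 'a"
  assumes N: "vector_norm scale nrm" and R: "\<And>r x. scale (of_real r) x = r *\<^sub>R x"
  obtains J where "\<And>y. linear (J y)" "\<And>x y. \<bar>J y x\<bar> \<le> nrm y * nrm x" "\<And>y. J y y = nrm y * nrm y"
proof -
  interpret vector_norm scale nrm by (rule N)
  have hom: "nrm (t *\<^sub>R x) = \<bar>t\<bar> * nrm x" for t x
    using homogeneous[of "of_real t" x] by (simp add: R)
  have "sublinear nrm" by (simp add: sublinear_def triangle hom)
  then have "\<exists>f. linear f \<and> f \<le> nrm \<and> f y = nrm y" for y
    using sublinear_support by metis
  then obtain f where f: "\<And>y. linear (f y)" "\<And>y. f y \<le> nrm" "\<And>y. f y y = nrm y" by metis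
  have "\<bar>f y x\<bar> \<le> nrm x" for x y
    using f(2)[of y] hom[of "-1" x] linear_neg[OF f(1), of y x]
    by (auto simp: le_fun_def abs_le_iff dest: spec[of _ "- x"])
  then show ?thesis
    by (intro that[of "\<lambda>y x. nrm y * f y x"])
      (auto simp: linear_iff linear_add[OF f(1)] linear_scale[OF f(1)] f(3) distrib_left
        abs_mult nonneg mult_left_mono)
qed

text \<open>Averaging \<open>J (T s y) (T s x)\<close> over \<open>s\<close> preserves the diagonal because, the \<open>T s\<close> being isometries,
  the averaged function is constant for \<open>x = y\<close>. The scalar-linear extension stays invariant since
  \<open>T s\<close> commutes with the scalar \<open>e\<close>.\<close>
lemma invariant_semi_inner_product:
  fixes scale :: "'k::real_or_complex \<Rightarrow> 'a::real_vector \<Rightarrow> 'a"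
    and T :: "'s::{semigroup_mult,topological_space} \<Rightarrow> 'a \<Rightarrow> 'a"
  assumes N: "vector_norm scale nrm" and R: "\<And>r x. scale (of_real r) x = r *\<^sub>R x"
    and linear: "\<And>s. Vector_Spaces.linear scale scale (T s)"
    and hom: "\<And>s t x. T (s * t) x = T s (T t x)"
    and isometric: "\<And>s x. nrm (T s x) = nrm x"
    and \<phi>: "right_invariant_mean (\<phi> :: ('s \<Rightarrow>\<^sub>C real) \<Rightarrow> real)"
    and discrete: "(euclidean :: 's topology) = discrete_topology UNIV"
  obtains sip :: "'a \<Rightarrow> 'a \<Rightarrow> 'k" where "semi_inner_product scale sip" "induces_norm sip nrm"
    "\<And>x y s. sip (T s x) (T s y) = sip x y"
proof -
  interpret vector_norm scale nrm by (rule N)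
  obtain J where J: "\<And>y. linear (J y)" "\<And>x y. \<bar>J y x\<bar> \<le> nrm y * nrm x"
    "\<And>y. J y y = nrm y * nrm y"
    using norm_duality_selection[OF N R] by blast
  obtain e :: 'k where e: "is_imaginary_unit e" using imaginary_unit_exists by blast
  have T_add: "T s (x + y) = T s x + T s y" and T_scale: "T s (scale c x) = scale c (T s x)"
    for s x y c using linear by (auto simp: Vector_Spaces.linear_iff)
  have T_scaleR: "T s (r *\<^sub>R x) = r *\<^sub>R T s x" for s r x using T_scale[of s "of_real r"] by (simp add: R)
  define F where "F y x = Bcontfun (\<lambda>s. J (T s y) (T s x))" for x y
  define g where "g y x = \<phi> (F y x)" for x y
  note C = discrete_C_norm[OF discrete]
  have C_r: "f \<in> C_r" for f :: "'s \<Rightarrow>\<^sub>C real" using C[of f] by (simp add: C_norm_def)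
  have bound: "\<bar>J (T s y) (T s x)\<bar> \<le> nrm y * nrm x" for s x y
    using J(2)[of "T s y" "T s x"] by (simp add: isometric)
  have app: "apply_bcontfun (F y x) s = J (T s y) (T s x)" for x y s
  proof -
    have "(\<lambda>s. J (T s y) (T s x)) \<in> bcontfun"
      by (rule bcontfun_normI[OF discrete_continuous_on[OF discrete], where b = "nrm y * nrm x"])
        (simp add: bound)
    then show ?thesis by (simp add: F_def Bcontfun_inverse)
  qed
  have g_linear: "linear (g y)" for y
  proof (rule linearI)
    fix x z :: 'a and r :: real
    have "F y (x + z) = F y x + F y z"
      by (rule bcontfun_eqI) (simp add: app T_add linear_add[OF J(1)])
    then show "g y (x + z) = g y x + g y z" by (simp add: g_def mean_add[OF \<phi> C C])
    have "F y (r *\<^sub>R x) = r *\<^sub>R F y x"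
      by (rule bcontfun_eqI) (simp add: app T_scaleR linear_scale[OF J(1)])
    then show "g y (r *\<^sub>R x) = r *\<^sub>R g y x" by (simp add: g_def mean_scaleR[OF \<phi> C])
  qed
  have g_le: "g y x \<le> nrm y * nrm x" for x y
    unfolding g_def by (rule mean_le[OF \<phi> C]) (use bound in \<open>simp add: app abs_le_iff\<close>)
  have g_ge: "nrm y * nrm y \<le> g y y" for y
    unfolding g_def by (rule mean_ge[OF \<phi> C]) (simp add: app J(3) isometric)
  have g_eq: "g y y = nrm y * nrm y" for y using g_le[of y y] g_ge[of y] by simp
  have g_inv: "g (T s y) (T s x) = g y x" for s x y
  proof -
    have "rtranslate (F y x) s = F (T s y) (T s x)"
      by (rule bcontfun_eqI) (simp add: apply_rtranslate[OF C_r] app hom)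
    then show ?thesis using mean_rtranslate[OF \<phi> C, of "F y x" s] by (simp add: g_def)
  qed
  define sip where "sip x y = linear_extension e scale (g y) x" for x y
  have diag: "sip x x = of_real ((nrm x)\<^sup>2)" for x
    unfolding sip_def
    using linear_extension_attained[OF N R e g_linear g_le g_eq] by (simp add: g_eq power2_eq_square)
  have cs: "norm (sip x y) \<le> nrm y * nrm x" for x y
    unfolding sip_def by (rule norm_linear_extension_le[OF N R e g_linear g_le])
  have "semi_inner_product scale sip"
  proof (rule semi_inner_product.intro[OF vector_space_axioms semi_inner_product_axioms.intro])
    fix x y
    show "Vector_Spaces.linear scale (*) (\<lambda>x. sip x y)"
      unfolding sip_def by (rule linear_linear_extension[OF vector_space_axioms R e g_linear])
    show "\<exists>r>0. sip x x = of_real r" if "x \<noteq> 0"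
      using that diag eq_zero_iff by (metis zero_less_power2)
    have "(norm (sip x y))\<^sup>2 \<le> (nrm y * nrm x)\<^sup>2" using cs by (rule power_mono) simp
    then show "(norm (sip x y))\<^sup>2 \<le> norm (sip x x) * norm (sip y y)"
      by (simp add: diag norm_power power_mult_distrib mult.commute)
  qed
  moreover have "induces_norm sip nrm" by (simp add: induces_norm_def diag)
  moreover have "sip (T s x) (T s y) = sip x y" for x y s
    by (simp add: sip_def linear_extension_def T_scale[symmetric] g_inv)
  ultimately show ?thesis by (rule that)
qed

section \<open>Isometric renorming\<close>

theorem theorem4p13:
  fixes scale :: "'k::real_or_complex \<Rightarrow> 'a::banach \<Rightarrow> 'a"
    and T :: "'s::{semigroup_mult,topological_space} \<Rightarrow> ('a \<Rightarrow>\<^sub>L 'a)"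
    and m M :: real
  assumes banach: "banach_space scale"
    and linear: "\<And>s. Vector_Spaces.linear scale scale (blinfun_apply (T s))"
    and homomorphism: "\<And>s t. T (s * t) = T s o\<^sub>L T t"
    and amenable: "weakly_right_amenable TYPE('s)"
    and sot_continuous: "continuous_map euclidean strong_operator_topology T"
    and pos: "m > 0" "M > 0"
    and bounds: "\<And>s x. m * norm x \<le> norm (T s x) \<and> norm (T s x) \<le> M * norm x"
  shows "\<exists>nrm :: 'a \<Rightarrow> real.
           vector_norm scale nrm \<and>
           (\<forall>x s. m * norm x \<le> nrm x \<and> nrm x \<le> M * norm x \<and> nrm (T s x) = nrm x) \<and>
           ((euclidean :: 's topology) = discrete_topology UNIV \<longrightarrow>
              (\<exists>sip :: 'a \<Rightarrow> 'a \<Rightarrow> 'k.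
                 semi_inner_product scale sip \<and> induces_norm sip nrm \<and>
                 (\<forall>x y s. sip (T s x) (T s y) = sip x y)))"
proof -
  interpret banach_space scale by (rule banach)
  obtain \<phi> :: "('s \<Rightarrow>\<^sub>C real) \<Rightarrow> real" where \<phi>: "right_invariant_mean \<phi>"
    using amenable unfolding weakly_right_amenable_def by blast
  have above: "\<And>s x. norm (T s x) \<le> M * norm x" and below: "\<And>s x. m * norm x \<le> norm (T s x)"
    using bounds by auto
  define nrm where "nrm x = \<phi> (orbit_norm T x)" for x
  note props = vector_norm_mean_orbit_norm[OF vector_norm_axioms linear homomorphism
      sot_continuous above pos(1) below \<phi>, folded nrm_def]
  have apply_hom: "T (s * t) x = T s (T t x)" for s t x by (simp add: homomorphism)
  have "\<exists>sip :: 'a \<Rightarrow> 'a \<Rightarrow> 'k. semi_inner_product scale sip \<and> induces_norm sip nrm \<and>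
      (\<forall>x y s. sip (T s x) (T s y) = sip x y)"
    if discrete: "(euclidean :: 's topology) = discrete_topology UNIV"
    by (rule invariant_semi_inner_product[where T = "\<lambda>s. blinfun_apply (T s)",
          OF props(1) scale_of_real linear apply_hom props(2) \<phi> discrete]) blast
  then show ?thesis using props by blast
qed

end
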